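(* Let $n\ge 1$ and let $\Sigma\subset\mathbb R^{n+1}$ be a closed set which is parabolic ADR with constant $M$ and which satisfies the (two-sided) corkscrew condition with constant $\gamma_0\in(0,1)$. Assume in addition that $\Sigma$ is either time-forward ADR with constant $M'$ or time-backward ADR with constant $M'$. Then $\Sigma$ satisfies the weak time-synchronized two cube condition with a constant $\gamma_1\in(0,1)$ depending only on $n,M,\gamma_0,M'$. Furthermore, given $(X,t)\in\Sigma$ with $T_0<t<T_1$ and $0<r<\operatorname{diam}\Sigma$, the two time-synchronized cubes provided by this condition can be chosen to be contained in $Q_r^{+}(X,t)$ if $\Sigma$ is time-forward ADR, and contained in $Q_r^{-}(X,t)$ if $\Sigma$ is time-backward ADR.
   Context: Points of $\mathbb R^{n+1}$ are written $(X,t)$ with $X=(x_1,\dots,x_n)\in\mathbb R^n$, $t\in\mathbb R$. The parabolic distance is $d_p((X,t),(Y,s))=|X-Y|+|t-s|^{1/2}$, and diameters and distances are measured in this metric. The parabolic cube is $Q_r(X,t)=\{(Y,s): |y_i-x_i|<r,\ i=1,\dots,n,\ |t-s|<r^2\}$, with halves $Q_r^+(X,t)=Q_r(X,t)\cap\{s\ge t\}$ and $Q_r^-(X,t)=Q_r(X,t)\cap\{s\le t\}$. For $\eta\ge0$, $\mathcal H^\eta_p$ denotes the $\eta$-dimensional Hausdorff measure defined via coverings whose diameters are measured in $d_p$. For a closed set $\Sigma$, $\sigma=\mathcal H^{n+1}_p$ restricted to $\Sigma$, $\Delta(X,t,r)=\Sigma\cap Q_r(X,t)$, $\Delta^\pm(X,t,r)=\Delta(X,t,r)\cap\{s\ge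 t\}$ resp. $\{s\le t\}$, $T_0=\inf\{t:\exists (X,t)\in\Sigma\}$, $T_1=\sup\{t:\exists(X,t)\in\Sigma\}$. Parabolic ADR with constant $M\ge1$: $M^{-1}r^{n+1}\le\sigma(\Delta(X,t,r))\le Mr^{n+1}$ for all $(X,t)\in\Sigma$ with $T_0<t<T_1$ and $0<r<\operatorname{diam}\Sigma$. Time-forward ADR with constant $M'\ge1$: $\Sigma$ is parabolic ADR, $T_1=\infty$, and $\sigma(\Delta^+(X,t,r))\ge (M')^{-1}r^{n+1}$ for every $(X,t)\in\Sigma$ with $T_0<t$ (and every admissible $r>0$). Time-backward ADR: $\Sigma$ is parabolic ADR, $T_0=-\infty$, and $\sigma(\Delta^-(X,t,r))\ge (M')^{-1}r^{n+1}$ for every $(X,t)\in\Sigma$ with $t<T_1$. Corkscrew condition with constant $\gamma_0\in(0,1)$: for all $(X,t)\in\Sigma$ with $T_0<t<T_1$ and all $0<r<\operatorname{diam}\Sigma$ there are two parabolic cubes $Q_\rho(X_1,t_1),Q_\rho(X_2,t_2)\subset Q_r(X,t)$ with $\gamma_0r\le\rho<r$ such that $Q_\rho(X_1,t_1)\cap(\mathbb R^n\times(T_0,T_1))$ and $Q_\rho(X_2,t_2)\cap(\mathbb R^n\times(T_0,T_1))$ belong to different connected components of $\mathbb R^{n+1}\setminus\Sigma$. Weak time-synchronized two cube condition with constant $\gamma_1\in(0,1)$: the same as the corkscrew condition with $\gamma_0$ replaced by $\gamma_1$ and with the additional requirement $t_1=t_2$. *)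

theory Defs
  imports "HOL-Analysis.Analysis"
begin

text \<open>Points of R^(n+1) are pairs (X,t) with X :: real^'n (so n = CARD('n) \<ge> 1).\<close>

type_synonym 'n ppoint = "(real^'n) \<times> real"

definition pdist :: "'n::finite ppoint \<Rightarrow> 'n ppoint \<Rightarrow> real" where
  "pdist p q = norm (fst p - fst q) + sqrt \<bar>snd p - snd q\<bar>"

text \<open>Parabolic diameter (possibly infinite); diam of the empty set is 0.\<close>
definition pdiam :: "'n::finite ppoint set \<Rightarrow> ennreal" where
  "pdiam A = (SUP x\<in>A. SUP y\<in>A. ennreal (pdist x y))"

definition hausdorff_p_content :: "real \<Rightarrow> real \<Rightarrow> 'n::finite ppoint set \<Rightarrow> ennreal" where
  "hausdorff_p_content \<eta> \<delta> A =
     (INF C\<in>{C :: nat \<Rightarrow> 'n ppoint set. A \<subseteq> (\<Union>i. C i) \<and> (\<forall>i. pdiam (C i) \<le> ennreal \<delta>)}.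
        (\<Sum>i. ennreal (enn2real (pdiam (C i)) powr \<eta>)))"

definition hausdorff_p :: "real \<Rightarrow> 'n::finite ppoint set \<Rightarrow> ennreal" where
  "hausdorff_p \<eta> A = (SUP \<delta>\<in>{0<..}. hausdorff_p_content \<eta> \<delta> A)"

definition surf :: "'n::finite ppoint set \<Rightarrow> 'n ppoint set \<Rightarrow> ennreal" where
  "surf \<Sigma> A = hausdorff_p (real CARD('n) + 1) (\<Sigma> \<inter> A)"

definition pcube :: "'n::finite ppoint \<Rightarrow> real \<Rightarrow> 'n ppoint set" where
  "pcube p r = {q. (\<forall>i. \<bar>fst q $ i - fst p $ i\<bar> < r) \<and> \<bar>snd p - snd q\<bar> < r^2}"

definition pcube_plus :: "'n::finite ppoint \<Rightarrow> real \<Rightarrow> 'n ppoint set" where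
  "pcube_plus p r = pcube p r \<inter> {q. snd q \<ge> snd p}"

definition pcube_minus :: "'n::finite ppoint \<Rightarrow> real \<Rightarrow> 'n ppoint set" where
  "pcube_minus p r = pcube p r \<inter> {q. snd q \<le> snd p}"

definition T0 :: "'n::finite ppoint set \<Rightarrow> ereal" where
  "T0 \<Sigma> = (INF p\<in>\<Sigma>. ereal (snd p))"

definition T1 :: "'n::finite ppoint set \<Rightarrow> ereal" where
  "T1 \<Sigma> = (SUP p\<in>\<Sigma>. ereal (snd p))"

definition strip :: "'n::finite ppoint set \<Rightarrow> 'n ppoint set" where
  "strip \<Sigma> = {q. T0 \<Sigma> < ereal (snd q) \<and> ereal (snd q) < T1 \<Sigma>}"

definition parabolic_ADR :: "'n::finite ppoint set \<Rightarrow> real \<Rightarrow> bool" where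
  "parabolic_ADR \<Sigma> M \<longleftrightarrow> M \<ge> 1 \<and>
     (\<forall>p\<in>\<Sigma>. T0 \<Sigma> < ereal (snd p) \<and> ereal (snd p) < T1 \<Sigma> \<longrightarrow>
        (\<forall>r. 0 < r \<and> ennreal r < pdiam \<Sigma> \<longrightarrow>
           ennreal (r ^ (CARD('n) + 1) / M) \<le> surf \<Sigma> (pcube p r) \<and>
           surf \<Sigma> (pcube p r) \<le> ennreal (M * r ^ (CARD('n) + 1))))"

definition time_forward_ADR :: "'n::finite ppoint set \<Rightarrow> real \<Rightarrow> bool" where
  "time_forward_ADR \<Sigma> M' \<longleftrightarrow> M' \<ge> 1 \<and> (\<exists>M. parabolic_ADR \<Sigma> M) \<and> T1 \<Sigma> = \<infinity> \<and>
     (\<forall>p\<in>\<Sigma>. T0 \<Sigma> < ereal (snd p) \<longrightarrow>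
        (\<forall>r. 0 < r \<and> ennreal r < pdiam \<Sigma> \<longrightarrow>
           ennreal (r ^ (CARD('n) + 1) / M') \<le> surf \<Sigma> (pcube_plus p r)))"

definition time_backward_ADR :: "'n::finite ppoint set \<Rightarrow> real \<Rightarrow> bool" where
  "time_backward_ADR \<Sigma> M' \<longleftrightarrow> M' \<ge> 1 \<and> (\<exists>M. parabolic_ADR \<Sigma> M) \<and> T0 \<Sigma> = -\<infinity> \<and>
     (\<forall>p\<in>\<Sigma>. ereal (snd p) < T1 \<Sigma> \<longrightarrow>
        (\<forall>r. 0 < r \<and> ennreal r < pdiam \<Sigma> \<longrightarrow>
           ennreal (r ^ (CARD('n) + 1) / M') \<le> surf \<Sigma> (pcube_minus p r)))"

definition separated_cubes :: "'n::finite ppoint set \<Rightarrow> 'n ppoint \<Rightarrow> 'n ppoint \<Rightarrow> real \<Rightarrow> bool" where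
  "separated_cubes \<Sigma> p1 p2 \<rho> \<longleftrightarrow>
     (\<exists>U\<in>components (- \<Sigma>). \<exists>V\<in>components (- \<Sigma>). U \<noteq> V \<and>
        pcube p1 \<rho> \<inter> strip \<Sigma> \<subseteq> U \<and> pcube p2 \<rho> \<inter> strip \<Sigma> \<subseteq> V)"

definition corkscrew :: "'n::finite ppoint set \<Rightarrow> real \<Rightarrow> bool" where
  "corkscrew \<Sigma> \<gamma> \<longleftrightarrow> 0 < \<gamma> \<and> \<gamma> < 1 \<and>
     (\<forall>p\<in>\<Sigma>. T0 \<Sigma> < ereal (snd p) \<and> ereal (snd p) < T1 \<Sigma> \<longrightarrow>
        (\<forall>r. 0 < r \<and> ennreal r < pdiam \<Sigma> \<longrightarrow>
           (\<exists>\<rho> p1 p2. \<gamma> * r \<le> \<rho> \<and> \<rho> < r \<and>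
              pcube p1 \<rho> \<subseteq> pcube p r \<and> pcube p2 \<rho> \<subseteq> pcube p r \<and>
              separated_cubes \<Sigma> p1 p2 \<rho>)))"

definition weak_ts_two_cube_in ::
  "'n::finite ppoint set \<Rightarrow> real \<Rightarrow> ('n ppoint \<Rightarrow> real \<Rightarrow> 'n ppoint set) \<Rightarrow> bool" where
  "weak_ts_two_cube_in \<Sigma> \<gamma> R \<longleftrightarrow> 0 < \<gamma> \<and> \<gamma> < 1 \<and>
     (\<forall>p\<in>\<Sigma>. T0 \<Sigma> < ereal (snd p) \<and> ereal (snd p) < T1 \<Sigma> \<longrightarrow>
        (\<forall>r. 0 < r \<and> ennreal r < pdiam \<Sigma> \<longrightarrow>
           (\<exists>\<rho> p1 p2. \<gamma> * r \<le> \<rho> \<and> \<rho> < r \<and>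
              pcube p1 \<rho> \<subseteq> R p r \<and> pcube p2 \<rho> \<subseteq> R p r \<and>
              snd p1 = snd p2 \<and>
              separated_cubes \<Sigma> p1 p2 \<rho>)))"

definition weak_ts_two_cube :: "'n::finite ppoint set \<Rightarrow> real \<Rightarrow> bool" where
  "weak_ts_two_cube \<Sigma> \<gamma> \<longleftrightarrow> weak_ts_two_cube_in \<Sigma> \<gamma> pcube"

end

theory Submission
  imports Defs
begin

text \<open>
  A time layer of thickness \<open>(r/m)\<^sup>2\<close> in a cube of radius \<open>r\<close> is
  covered by at most \<open>m^n\<close> cubes of radius comparable to \<open>r/m\<close>, so by
  upper regularity it carries surface measure \<open>O(r^(n+1)/m)\<close>. For large
  \<open>m\<close> this is less than what time-forward regularity guarantees, so from every point
  of \<open>\<Sigma>\<close> one can advance along \<open>\<Sigma>\<close> by a definite fraction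
  of \<open>r\<^sup>2\<close>. Advance once and take the corkscrew cubes of radius
  \<open>\<rho>\<close> there, lying in components \<open>U\<close> and \<open>V\<close>, the one
  in \<open>V\<close> being the later one; having advanced, these cubes lie in \<open>t >
  T\<^sub>0\<close>, where the corkscrew condition is not vacuous. Slide a small cube at the
  centre of the later cube backwards in time. If it reaches the time of the earlier cube without
  touching \<open>\<Sigma>\<close>, it stays in \<open>V\<close> and is synchronized with a cube
  in \<open>U\<close>. Otherwise it is stopped by a last point \<open>q\<close> of
  \<open>\<Sigma>\<close>. Advance from \<open>q\<close> by a small multiple of
  \<open>\<rho>\<^sup>2\<close> and apply the corkscrew condition there: at least one of the two
  new cubes is not in \<open>V\<close>, while the part of the column later than \<open>q\<close>
  is in \<open>V\<close>, so they can be synchronized. The time-backward case follows by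
  reflecting time.
\<close>

subsection \<open>Subadditivity of the parabolic Hausdorff measure\<close>

lemma le_INF_add:
  fixes f :: "'a \<Rightarrow> ennreal"
  assumes "\<And>i. i \<in> I \<Longrightarrow> x \<le> f i + c"
  shows "x \<le> (INF i\<in>I. f i) + c"
proof (cases "c = top")
  case False
  then have "x - c \<le> (INF i\<in>I. f i)"
    using assms by (intro INF_greatest) (simp add: ennreal_minus_le_iff add.commute)
  then show ?thesis
    using False by (simp add: ennreal_minus_le_iff add.commute)
qed simp

lemma le_INF_add_INF:
  fixes f :: "'a \<Rightarrow> ennreal" and g :: "'b \<Rightarrow> ennreal"
  assumes "\<And>i j. i \<in> I \<Longrightarrow> j \<in> J \<Longrightarrow> x \<le> f i + g j"
  shows "x \<le> (INF i\<in>I. f i) + (INF j\<in>J. g j)"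
proof (rule le_INF_add)
  fix i assume "i \<in> I"
  then have "x \<le> (INF j\<in>J. g j) + f i"
    using assms by (intro le_INF_add) (simp add: add.commute)
  then show "x \<le> f i + (INF j\<in>J. g j)"
    by (simp add: add.commute)
qed

lemma hausdorff_p_content_mono:
  assumes "A \<subseteq> B"
  shows "hausdorff_p_content \<eta> \<delta> A \<le> hausdorff_p_content \<eta> \<delta> B"
  unfolding hausdorff_p_content_def using assms by (intro INF_superset_mono) auto

lemma hausdorff_p_mono:
  assumes "A \<subseteq> B"
  shows "hausdorff_p \<eta> A \<le> hausdorff_p \<eta> B"
  unfolding hausdorff_p_def by (intro SUP_mono) (auto intro: hausdorff_p_content_mono[OF assms])

lemma pdiam_empty [simp]: "pdiam {} = 0"
  by (simp add: pdiam_def bot_ennreal)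

lemma hausdorff_p_content_Un:
  fixes A B :: "'n::finite ppoint set"
  shows "hausdorff_p_content \<eta> \<delta> (A \<union> B) \<le> hausdorff_p_content \<eta> \<delta> A + hausdorff_p_content \<eta> \<delta> B"
proof -
  define w where "w S = ennreal (enn2real (pdiam S) powr \<eta>)" for S :: "'n ppoint set"
  \<comment> \<open>\<open>0 powr \<eta>\<close> is 0 for every \<eta>, so padding a covering with
    empty sets costs nothing.\<close>
  have w_empty: "w {} = 0"
    by (simp add: w_def)
  have "hausdorff_p_content \<eta> \<delta> (A \<union> B) \<le> (\<Sum>i. w (C i)) + (\<Sum>i. w (D i))"
    if C: "A \<subseteq> (\<Union>i. C i)" "\<And>i. pdiam (C i) \<le> ennreal \<delta>"
      and D: "B \<subseteq> (\<Union>i. D i)" "\<And>i. pdiam (D i) \<le> ennreal \<delta>" for C D :: "nat \<Rightarrow> 'n ppoint set"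
  proof -
    \<comment> \<open>The two coverings become rows 0 and 1 of a double sequence whose other rows
      are empty; \<open>prod_decode\<close> enumerates it as one covering, and the double sum
      collapses to two series.\<close>
    define E where "E = (\<lambda>(m::nat, n). if m = 0 then C n else if m = 1 then D n else {})"
    have E_cover: "A \<union> B \<subseteq> (\<Union>i. E (prod_decode i))"
    proof -
      have "E (m, n) \<subseteq> (\<Union>i. E (prod_decode i))" for m n
        using prod_encode_inverse[of "(m, n)"] by (metis UNIV_I UN_upper)
      from this[of 0] this[of 1] have "C n \<subseteq> (\<Union>i. E (prod_decode i))" "D n \<subseteq> (\<Union>i. E (prod_decode i))" for n
        by (simp_all add: E_def)
      then have "(\<Union>i. C i) \<subseteq> (\<Union>i. E (prod_decode i))" "(\<Union>i. D i) \<subseteq> (\<Union>i. E (prod_decode i))"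
        by (simp_all only: UN_least)
      with C(1) D(1) show ?thesis
        by (intro Un_least) (auto intro: order_trans)
    qed
    have E_diam: "pdiam (E p) \<le> ennreal \<delta>" for p
      using C(2) D(2) by (auto simp: E_def split: prod.split)
    have "hausdorff_p_content \<eta> \<delta> (A \<union> B) \<le> (\<Sum>i. w (E (prod_decode i)))"
      unfolding hausdorff_p_content_def w_def using E_cover E_diam by (intro INF_lower) auto
    also have "\<dots> = (\<Sum>m. \<Sum>n. w (E (m, n)))"
      by (rule suminf_ennreal_2dimen) simp
    also have "\<dots> = (\<Sum>m\<in>{0, 1}. \<Sum>n. w (E (m, n)))"
      by (rule suminf_finite) (auto simp: E_def w_empty)
    also have "\<dots> = (\<Sum>i. w (C i)) + (\<Sum>i. w (D i))"
      by (simp add: E_def)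
    finally show ?thesis .
  qed
  then show ?thesis
    unfolding hausdorff_p_content_def[of _ _ A] hausdorff_p_content_def[of _ _ B] w_def
    by (intro le_INF_add_INF) auto
qed

lemma hausdorff_p_Un: "hausdorff_p \<eta> (A \<union> B) \<le> hausdorff_p \<eta> A + hausdorff_p \<eta> B"
  unfolding hausdorff_p_def[of _ "A \<union> B"]
proof (rule SUP_least)
  fix \<delta> :: real assume "\<delta> \<in> {0<..}"
  then have "hausdorff_p_content \<eta> \<delta> S \<le> hausdorff_p \<eta> S" for S :: "'a ppoint set"
    unfolding hausdorff_p_def by (rule SUP_upper)
  then show "hausdorff_p_content \<eta> \<delta> (A \<union> B) \<le> hausdorff_p \<eta> A + hausdorff_p \<eta> B"
    using hausdorff_p_content_Un[of \<eta> \<delta> A B] by (meson add_mono order_trans)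
qed

lemma hausdorff_p_empty [simp]: "hausdorff_p \<eta> ({} :: 'n::finite ppoint set) = 0"
proof -
  have "hausdorff_p_content \<eta> \<delta> ({} :: 'n ppoint set) \<le> 0" for \<delta>
    unfolding hausdorff_p_content_def by (rule INF_lower2[of "\<lambda>_. {}"]) auto
  then show ?thesis
    by (simp add: hausdorff_p_def)
qed

lemma surf_mono: "A \<subseteq> B \<Longrightarrow> surf \<Sigma> A \<le> surf \<Sigma> B"
  unfolding surf_def by (intro hausdorff_p_mono) auto

lemma surf_UN_le:
  assumes "finite I"
  shows "surf \<Sigma> (\<Union>i\<in>I. S i) \<le> (\<Sum>i\<in>I. surf \<Sigma> (S i))"
  using assms
proof (induction rule: finite_induct)
  case (insert i I)
  have "surf \<Sigma> (\<Union>j\<in>insert i I. S j) \<le> surf \<Sigma> (S i) + surf \<Sigma> (\<Union>j\<in>I. S j)"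
    by (simp add: surf_def Int_Un_distrib hausdorff_p_Un)
  also have "\<dots> \<le> surf \<Sigma> (S i) + (\<Sum>j\<in>I. surf \<Sigma> (S j))"
    using insert.IH by (rule add_left_mono)
  finally show ?case
    using insert.hyps by simp
qed (simp add: surf_def)

subsection \<open>Surface measure of thin time layers\<close>

lemma abs_diff_le_of_floor_eq:
  fixes x y c :: real
  assumes "\<lfloor>x * c\<rfloor> = \<lfloor>y * c\<rfloor>" "0 < c"
  shows "\<bar>x - y\<bar> \<le> 1 / c"
proof -
  have "\<bar>x * c - y * c\<bar> \<le> 1"
    using assms(1) by linarith
  then have "\<bar>x - y\<bar> * c \<le> 1"
    using assms(2) by (metis abs_mult abs_of_pos left_diff_distrib)
  then show ?thesis
    using assms(2) by (simp add: field_simps)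
qed

text \<open>A grid of \<open>m ^ n\<close> spatial cells of side \<open>2 * r / m\<close> cuts the
  layer into pieces, each inside a cube of radius \<open>3 * r / m\<close> about one of its own
  points. Upper regularity bounds each piece by \<open>M * (3 * r / m) ^ (n + 1)\<close>, so one
  factor \<open>1 / m\<close> survives the summation.\<close>

lemma surf_thin_layer_le:
  fixes \<Sigma> :: "'n::finite ppoint set"
  assumes ADR: "parabolic_ADR \<Sigma> M"
    and r: "0 < r" "ennreal r < pdiam \<Sigma>"
    and m: "3 \<le> m"
    and S: "S \<subseteq> \<Sigma> \<inter> pcube p r"
    and time_S: "\<And>q. q \<in> S \<Longrightarrow> T0 \<Sigma> < ereal (snd q) \<and> ereal (snd q) < T1 \<Sigma>"
    and thin: "\<And>q q'. q \<in> S \<Longrightarrow> q' \<in> S \<Longrightarrow> \<bar>snd q - snd q'\<bar> \<le> (r / real m)\<^sup>2"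
  shows "surf \<Sigma> S \<le> ennreal (M * 3 ^ (CARD('n) + 1) * r ^ (CARD('n) + 1) / real m)"
proof -
  define n where "n = CARD('n)"
  define I where "I = ((UNIV :: 'n set) \<rightarrow>\<^sub>E {0..<int m})"
  define cell where "cell q i = \<lfloor>(fst q $ i - fst p $ i + r) * (real m / (2 * r))\<rfloor>" for q :: "'n ppoint" and i
  define K where "K = M * (3 * r / real m) ^ (n + 1)"
  have M: "1 \<le> M" using ADR by (simp add: parabolic_ADR_def)
  have K: "0 \<le> K" using M r by (simp add: K_def)
  have card_I: "card I = m ^ n"
    by (simp add: I_def n_def card_PiE)
  have fin_I: "finite I"
    by (simp add: I_def finite_PiE)
  have cell_I: "cell q \<in> I" if "q \<in> S" for q
  proof -
    have "\<bar>fst q $ i - fst p $ i\<bar> < r" for i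
      using that S by (auto simp: pcube_def)
    then have "0 < fst q $ i - fst p $ i + r" "fst q $ i - fst p $ i + r < 2 * r" for i
      by (smt (verit))+
    moreover have c: "0 < real m / (2 * r)"
      using m r by simp
    ultimately have "0 < (fst q $ i - fst p $ i + r) * (real m / (2 * r))"
      "(fst q $ i - fst p $ i + r) * (real m / (2 * r)) < 2 * r * (real m / (2 * r))" for i
      by (blast intro: mult_pos_pos mult_strict_right_mono)+
    moreover have "2 * r * (real m / (2 * r)) = real m"
      using r by simp
    ultimately have "0 < (fst q $ i - fst p $ i + r) * (real m / (2 * r))"
      "(fst q $ i - fst p $ i + r) * (real m / (2 * r)) < real m" for i
      by simp_all
    then have "0 \<le> cell q i" "cell q i < int m" for i
      unfolding cell_def by (simp_all add: floor_less_iff less_imp_le)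
    then show ?thesis
      by (auto simp: I_def)
  qed
  have cell_bound: "surf \<Sigma> {q \<in> S. cell q = f} \<le> ennreal K" for f
  proof (cases "{q \<in> S. cell q = f} = {}")
    case True
    show ?thesis
      unfolding True by (simp add: surf_def)
  next
    case False
    then obtain z where z: "z \<in> S" "cell z = f" by blast
    \<comment> \<open>The cell bound \<open>2 * r / m\<close> is not strict while
      \<open>pcube\<close> is open; the radius \<open>3 * r / m\<close> leaves room in space and in
      time.\<close>
    have "{q \<in> S. cell q = f} \<subseteq> pcube z (3 * r / real m)"
    proof
      fix q assume "q \<in> {q \<in> S. cell q = f}"
      then have q: "q \<in> S" "cell q = cell z" using z by auto
      have "\<bar>fst q $ i - fst z $ i\<bar> \<le> 2 * r / real m" for i
        using abs_diff_le_of_floor_eq[of "fst q $ i - fst p $ i + r" "real m / (2 * r)"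
            "fst z $ i - fst p $ i + r"] fun_cong[OF q(2), of i] m r
        by (simp add: cell_def)
      moreover have "2 * r / real m < 3 * r / real m"
        using m r by (simp add: divide_strict_right_mono)
      moreover have "(r / real m)\<^sup>2 < (3 * r / real m)\<^sup>2"
        using m r by (simp add: power_divide power_mult_distrib divide_strict_right_mono)
      ultimately show "q \<in> pcube z (3 * r / real m)"
        using thin[OF z(1) q(1)] by (auto simp: pcube_def intro: le_less_trans)
    qed
    then have "surf \<Sigma> {q \<in> S. cell q = f} \<le> surf \<Sigma> (pcube z (3 * r / real m))"
      by (rule surf_mono)
    also have "\<dots> \<le> ennreal K"
    proof -
      \<comment> \<open>Since \<open>3 \<le> m\<close>, the radius is at most \<open>r\<close> and
        hence admissible for the regularity bound.\<close>
      have "3 * r / real m \<le> r" "0 < 3 * r / real m" using m r by (simp_all add: field_simps)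
      moreover from this have "ennreal (3 * r / real m) < pdiam \<Sigma>"
        using r(2) by (meson ennreal_leI le_less_trans)
      moreover have "z \<in> \<Sigma>" using z S by auto
      ultimately show ?thesis
        using ADR time_S[OF z(1)] unfolding parabolic_ADR_def K_def n_def by blast
    qed
    finally show ?thesis .
  qed
  have "S \<subseteq> (\<Union>f\<in>I. {q \<in> S. cell q = f})"
    using cell_I by auto
  then have "surf \<Sigma> S \<le> surf \<Sigma> (\<Union>f\<in>I. {q \<in> S. cell q = f})"
    by (rule surf_mono)
  also have "\<dots> \<le> (\<Sum>f\<in>I. surf \<Sigma> {q \<in> S. cell q = f})"
    using fin_I by (rule surf_UN_le)
  also have "\<dots> \<le> (\<Sum>f\<in>I. ennreal K)"
    by (intro sum_mono cell_bound)
  also have "\<dots> = ennreal (real (m ^ n) * K)"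
    using K by (simp add: card_I ennreal_mult ennreal_of_nat_eq_real_of_nat)
  also have "real (m ^ n) * K = M * 3 ^ (n + 1) * r ^ (n + 1) / real m"
    using m by (simp add: K_def power_divide power_mult_distrib)
  finally show ?thesis
    by (simp add: n_def)
qed

section \<open>Definite progress in time along \<Sigma>\<close>

definition advances :: "'n::finite ppoint set \<Rightarrow> real \<Rightarrow> bool" where
  "advances \<Sigma> \<delta> \<longleftrightarrow>
     (\<forall>p\<in>\<Sigma>. T0 \<Sigma> < ereal (snd p) \<and> ereal (snd p) < T1 \<Sigma> \<longrightarrow>
        (\<forall>r. 0 < r \<and> ennreal r < pdiam \<Sigma> \<longrightarrow>
           (\<exists>q\<in>\<Sigma> \<inter> pcube p r. snd p + (\<delta> * r)\<^sup>2 \<le> snd q)))"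

text \<open>Mirror image of \<open>advances\<close>. One-sided regularity enters the sliding
  argument only in this pointwise form, so that the reduction of the backward case reflects points
  and cubes rather than measures.\<close>

definition retreats :: "'n::finite ppoint set \<Rightarrow> real \<Rightarrow> bool" where
  "retreats \<Sigma> \<delta> \<longleftrightarrow>
     (\<forall>p\<in>\<Sigma>. T0 \<Sigma> < ereal (snd p) \<and> ereal (snd p) < T1 \<Sigma> \<longrightarrow>
        (\<forall>r. 0 < r \<and> ennreal r < pdiam \<Sigma> \<longrightarrow>
           (\<exists>q\<in>\<Sigma> \<inter> pcube p r. snd q \<le> snd p - (\<delta> * r)\<^sup>2)))"

text \<open>Beyond the threshold on \<open>m\<close>, the layer bound, of order
  \<open>M / m\<close>, drops below the one-sided lower bound of order
  \<open>1 / M'\<close>.\<close>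

lemma surf_thin_layer_less:
  fixes \<Sigma> :: "'n::finite ppoint set"
  assumes "parabolic_ADR \<Sigma> M" "0 < r" "ennreal r < pdiam \<Sigma>" "3 \<le> m"
    "S \<subseteq> \<Sigma> \<inter> pcube p r"
    "\<And>q. q \<in> S \<Longrightarrow> T0 \<Sigma> < ereal (snd q) \<and> ereal (snd q) < T1 \<Sigma>"
    "\<And>q q'. q \<in> S \<Longrightarrow> q' \<in> S \<Longrightarrow> \<bar>snd q - snd q'\<bar> \<le> (r / real m)\<^sup>2"
    and M': "1 \<le> M'" "M * M' * 3 ^ (CARD('n) + 1) < real m"
  shows "surf \<Sigma> S < ennreal (r ^ (CARD('n) + 1) / M')"
proof -
  have "M * 3 ^ (CARD('n) + 1) * r ^ (CARD('n) + 1) / real m < r ^ (CARD('n) + 1) / M'"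
  proof -
    have "M * M' * 3 ^ (CARD('n) + 1) * r ^ (CARD('n) + 1) < real m * r ^ (CARD('n) + 1)"
      using M'(2) assms(2) by (intro mult_strict_right_mono) auto
    then show ?thesis
      using M'(1) assms(4) by (simp add: divide_less_eq less_divide_eq mult_ac)
  qed
  then have "ennreal (M * 3 ^ (CARD('n) + 1) * r ^ (CARD('n) + 1) / real m) < ennreal (r ^ (CARD('n) + 1) / M')"
    using assms(2) M'(1) by (intro ennreal_lessI) auto
  with surf_thin_layer_le[OF assms(1-7)] show ?thesis
    by (rule le_less_trans)
qed

text \<open>If no point of \<Sigma> in the cube were later than \<open>p\<close> by at least
  \<open>(r / real m)\<^sup>2\<close>, the whole forward half would be a thin layer and have too
  little measure.\<close>

lemma time_forward_ADR_advances:
  fixes \<Sigma> :: "'n::finite ppoint set"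
  assumes ADR: "parabolic_ADR \<Sigma> M" and fwd: "time_forward_ADR \<Sigma> M'"
    and m: "3 \<le> m" "M * M' * 3 ^ (CARD('n) + 1) < real m"
  shows "advances \<Sigma> (1 / real m)"
  unfolding advances_def
proof (intro ballI allI impI, elim conjE, rule ccontr)
  fix p r
  assume p: "p \<in> \<Sigma>" "T0 \<Sigma> < ereal (snd p)" "ereal (snd p) < T1 \<Sigma>"
    and r: "0 < r" "ennreal r < pdiam \<Sigma>"
    and none: "\<not> (\<exists>q\<in>\<Sigma> \<inter> pcube p r. snd p + (1 / real m * r)\<^sup>2 \<le> snd q)"
  have fwd': "1 \<le> M'" "T1 \<Sigma> = \<infinity>" "ennreal (r ^ (CARD('n) + 1) / M') \<le> surf \<Sigma> (pcube_plus p r)"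
    using fwd p r by (auto simp: time_forward_ADR_def)
  define S where "S = \<Sigma> \<inter> pcube_plus p r"
  have time_S: "snd p \<le> snd q \<and> snd q < snd p + (r / real m)\<^sup>2" if "q \<in> S" for q
    using that none by (auto simp: S_def pcube_plus_def not_le)
  have "surf \<Sigma> S < ennreal (r ^ (CARD('n) + 1) / M')"
  proof (rule surf_thin_layer_less[OF ADR r m(1)])
    show "S \<subseteq> \<Sigma> \<inter> pcube p r"
      by (auto simp: S_def pcube_plus_def)
    show "T0 \<Sigma> < ereal (snd q) \<and> ereal (snd q) < T1 \<Sigma>" if "q \<in> S" for q
      using time_S[OF that] p(2) fwd'(2) by (simp add: less_le_trans)
    show "\<bar>snd q - snd q'\<bar> \<le> (r / real m)\<^sup>2" if "q \<in> S" "q' \<in> S" for q q'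
      using time_S[OF that(1)] time_S[OF that(2)] by linarith
  qed (use fwd'(1) m(2) in auto)
  with fwd'(3) show False
    by (simp add: S_def surf_def Int_assoc[symmetric])
qed

lemma time_backward_ADR_retreats:
  fixes \<Sigma> :: "'n::finite ppoint set"
  assumes ADR: "parabolic_ADR \<Sigma> M" and bwd: "time_backward_ADR \<Sigma> M'"
    and m: "3 \<le> m" "M * M' * 3 ^ (CARD('n) + 1) < real m"
  shows "retreats \<Sigma> (1 / real m)"
  unfolding retreats_def
proof (intro ballI allI impI, elim conjE, rule ccontr)
  fix p r
  assume p: "p \<in> \<Sigma>" "T0 \<Sigma> < ereal (snd p)" "ereal (snd p) < T1 \<Sigma>"
    and r: "0 < r" "ennreal r < pdiam \<Sigma>"
    and none: "\<not> (\<exists>q\<in>\<Sigma> \<inter> pcube p r. snd q \<le> snd p - (1 / real m * r)\<^sup>2)"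
  have bwd': "1 \<le> M'" "T0 \<Sigma> = -\<infinity>" "ennreal (r ^ (CARD('n) + 1) / M') \<le> surf \<Sigma> (pcube_minus p r)"
    using bwd p r by (auto simp: time_backward_ADR_def)
  define S where "S = \<Sigma> \<inter> pcube_minus p r"
  have time_S: "snd q \<le> snd p \<and> snd p - (r / real m)\<^sup>2 < snd q" if "q \<in> S" for q
    using that none by (auto simp: S_def pcube_minus_def not_le)
  have "surf \<Sigma> S < ennreal (r ^ (CARD('n) + 1) / M')"
  proof (rule surf_thin_layer_less[OF ADR r m(1)])
    show "S \<subseteq> \<Sigma> \<inter> pcube p r"
      by (auto simp: S_def pcube_minus_def)
    show "T0 \<Sigma> < ereal (snd q) \<and> ereal (snd q) < T1 \<Sigma>" if "q \<in> S" for q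
      using time_S[OF that] p(3) bwd'(2) by (auto intro: le_less_trans[of _ "ereal (snd p)"])
    show "\<bar>snd q - snd q'\<bar> \<le> (r / real m)\<^sup>2" if "q \<in> S" "q' \<in> S" for q q'
      using time_S[OF that(1)] time_S[OF that(2)] by linarith
  qed (use bwd'(1) m(2) in auto)
  with bwd'(3) show False
    by (simp add: S_def surf_def Int_assoc[symmetric])
qed

subsection \<open>Sliding a cube in time\<close>

text \<open>A box times an interval is convex. Such a set is the track of a cube moving in time, and
  connectedness keeps it in a single component as long as it avoids \<Sigma>.\<close>

lemma connected_Collect_abs_nth_time:
  fixes x :: "real^'n::finite"
  shows "connected {q :: 'n ppoint. (\<forall>i. \<bar>fst q $ i - x $ i\<bar> < h) \<and> a < snd q \<and> snd q < b}"
proof -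
  have "{q :: 'n ppoint. (\<forall>i. \<bar>fst q $ i - x $ i\<bar> < h) \<and> a < snd q \<and> snd q < b}
      = {y. \<forall>i. y $ i \<in> {x $ i - h<..<x $ i + h}} \<times> {a<..<b}"
    by (auto simp: abs_less_iff) (smt (verit))+
  moreover have "convex {y :: real^'n. \<forall>i. y $ i \<in> {x $ i - h<..<x $ i + h}}"
    by (rule convex_box_cart) (simp only: Collect_mem_eq convex_real_interval)
  ultimately show ?thesis
    by (simp add: convex_Times convex_connected)
qed

text \<open>A closed set is cut by a compact box; this later yields a last point of \<Sigma> that
  blocks the slide.\<close>

lemma compact_Int_cylinder:
  fixes \<Sigma> :: "'n::finite ppoint set"
  assumes "closed \<Sigma>"
  shows "compact {q \<in> \<Sigma>. (\<forall>i. \<bar>fst q $ i - x $ i\<bar> \<le> h) \<and> a \<le> snd q \<and> snd q \<le> b}"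
proof -
  have "{q \<in> \<Sigma>. (\<forall>i. \<bar>fst q $ i - x $ i\<bar> \<le> h) \<and> a \<le> snd q \<and> snd q \<le> b}
      = \<Sigma> \<inter> (cbox (x - (\<chi> i. h)) (x + (\<chi> i. h)) \<times> cbox a b)"
    by (auto simp: mem_box_cart abs_le_iff) (smt (verit))+
  then show ?thesis
    using assms by (simp add: closed_Int_compact compact_Times)
qed

lemma mem_pcube_self: "0 < r \<Longrightarrow> p \<in> pcube p r"
  by (simp add: pcube_def)

lemma pcube_mono:
  assumes "0 \<le> r" "r \<le> s"
  shows "pcube p r \<subseteq> pcube p s"
proof -
  have "r\<^sup>2 \<le> s\<^sup>2" using assms by simp
  then show ?thesis
    using assms by (auto simp: pcube_def intro: less_le_trans)
qed

text \<open>A half cube is a box times a time interval: the spatial bound and the upper time bound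
  are inherited from the cube at \<open>c2\<close>, the lower time bound from the one at
  \<open>c1\<close>.\<close>

lemma Un_pcube_time_convex:
  assumes "pcube c1 \<rho> \<subseteq> pcube_plus p r" "pcube c2 \<rho> \<subseteq> pcube_plus p r"
    and "0 < \<rho>" "snd c1 \<le> snd c2"
    and x: "\<And>i. \<bar>x $ i - fst c2 $ i\<bar> < \<rho>"
    and t: "snd c1 - \<rho>\<^sup>2 < t" "t < snd c2 + \<rho>\<^sup>2"
  shows "(x, t) \<in> pcube_plus p r"
proof -
  have c: "c1 \<in> pcube_plus p r" "c2 \<in> pcube_plus p r" "(x, snd c2) \<in> pcube_plus p r"
    using assms(1-3) x mem_pcube_self[of \<rho>] by (blast, blast, auto simp: pcube_def subset_iff)
  have "snd p \<le> t"
  proof (cases "t \<le> snd c1")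
    case True
    then have "(fst c1, t) \<in> pcube c1 \<rho>"
      using t assms(3) by (auto simp: pcube_def)
    then show ?thesis
      using assms(1) by (auto simp: pcube_plus_def)
  next
    case False
    then show ?thesis
      using c(1) by (auto simp: pcube_plus_def)
  qed
  moreover have "t < snd p + r\<^sup>2"
  proof (cases "t \<le> snd c2")
    case True
    then show ?thesis
      using c(2) by (auto simp: pcube_plus_def pcube_def)
  next
    case False
    then have "(fst c2, t) \<in> pcube c2 \<rho>"
      using t assms(3) by (auto simp: pcube_def)
    then have "(fst c2, t) \<in> pcube_plus p r"
      using assms(2) by blast
    then show ?thesis
      by (auto simp: pcube_plus_def pcube_def)
  qed
  ultimately show ?thesis
    using c(3) by (auto simp: pcube_plus_def pcube_def)
qed

lemma separated_cubes_sym: "separated_cubes \<Sigma> p1 p2 \<rho> \<Longrightarrow> separated_cubes \<Sigma> p2 p1 \<rho>"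
  unfolding separated_cubes_def by metis

text \<open>For such sets the intersection with \<open>strip\<close> in
  \<open>separated_cubes\<close> disappears, so whole cubes lie in their components.\<close>

lemma subset_strip:
  assumes "T1 \<Sigma> = \<infinity>" "T0 \<Sigma> < ereal t" "A \<subseteq> {q. t \<le> snd q}"
  shows "A \<subseteq> strip \<Sigma>"
proof
  fix q assume "q \<in> A"
  then have "ereal t \<le> ereal (snd q)"
    using assms(3) by auto
  with assms(2) have "T0 \<Sigma> < ereal (snd q)"
    by (rule less_le_trans)
  then show "q \<in> strip \<Sigma>"
    using assms(1) by (simp add: strip_def)
qed

text \<open>The constant comes from two rounds of advancing and applying the corkscrew condition.
  The first yields cubes of radius \<rho> at least \<open>\<gamma>0 * \<delta> * r / 2\<close>; the
  second starts from \<open>\<rho> / 4\<close> and yields radius at least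
  \<open>\<gamma>0 * \<delta> * \<rho> / 8\<close>.\<close>

lemma weak_ts_two_cube_plus:
  fixes \<Sigma> :: "'n::finite ppoint set"
  assumes cl: "closed \<Sigma>" and cs: "corkscrew \<Sigma> \<gamma>0" and T1: "T1 \<Sigma> = \<infinity>"
    and adv: "advances \<Sigma> \<delta>" and \<delta>: "0 < \<delta>" "\<delta> < 1"
  shows "weak_ts_two_cube_in \<Sigma> ((\<gamma>0 * \<delta> / 4)\<^sup>2) pcube_plus"
proof -
  have \<gamma>0: "0 < \<gamma>0" "\<gamma>0 < 1" using cs by (auto simp: corkscrew_def)
  have cork: "\<exists>\<rho> p1 p2. \<gamma>0 * r \<le> \<rho> \<and> \<rho> < r \<and> pcube p1 \<rho> \<subseteq> pcube p r \<and> pcube p2 \<rho> \<subseteq> pcube p r \<and>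
              separated_cubes \<Sigma> p1 p2 \<rho>"
    if "p \<in> \<Sigma>" "T0 \<Sigma> < ereal (snd p)" "0 < r" "ennreal r < pdiam \<Sigma>" for p r
    using cs that T1 by (auto simp: corkscrew_def)
  have fwd: "\<exists>q\<in>\<Sigma>. q \<in> pcube p r \<and> snd p + (\<delta> * r)\<^sup>2 \<le> snd q"
    if "p \<in> \<Sigma>" "T0 \<Sigma> < ereal (snd p)" "0 < r" "ennreal r < pdiam \<Sigma>" for p r
    using adv that T1 by (auto simp: advances_def)
  have diam: "ennreal s < pdiam \<Sigma>" if "s \<le> r" "ennreal r < pdiam \<Sigma>" for s r
    using ennreal_leI[OF that(1)] that(2) by (rule le_less_trans)
  have later: "T0 \<Sigma> < ereal b" if "T0 \<Sigma> < ereal a" "a \<le> b" for a b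
    using that(1) by (rule less_le_trans) (simp add: that(2))
  \<comment> \<open>Second round: the cubes from the first round are given inside the half cube,
    with \<open>c2\<close> not earlier than \<open>c1\<close>.\<close>
  have main: "\<exists>\<rho> p1 p2. (\<gamma>0 * \<delta> / 4)\<^sup>2 * r \<le> \<rho> \<and> \<rho> < r \<and>
              pcube p1 \<rho> \<subseteq> pcube_plus p r \<and> pcube p2 \<rho> \<subseteq> pcube_plus p r \<and>
              snd p1 = snd p2 \<and> separated_cubes \<Sigma> p1 p2 \<rho>"
    if p: "T0 \<Sigma> < ereal (snd p)" and r: "0 < r" "ennreal r < pdiam \<Sigma>"
      and \<rho>: "\<gamma>0 * (\<delta> * r / 2) \<le> \<rho>" "\<rho> < r"
      and sub1: "pcube c1 \<rho> \<subseteq> pcube_plus p r" and sub2: "pcube c2 \<rho> \<subseteq> pcube_plus p r"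
      and sep: "separated_cubes \<Sigma> c1 c2 \<rho>" and le: "snd c1 \<le> snd c2"
    for p r \<rho> c1 c2
  proof -
    have \<rho>0: "0 < \<rho>"
      using \<rho>(1) \<gamma>0 \<delta> r by (smt (verit) divide_pos_pos mult_pos_pos)
    have strip: "A \<subseteq> strip \<Sigma>" if "A \<subseteq> pcube_plus p r" for A
      using that subset_strip[OF T1 p, of A] by (auto simp: pcube_plus_def)
    obtain U V where UV: "U \<in> components (- \<Sigma>)" "V \<in> components (- \<Sigma>)" "U \<noteq> V"
      "pcube c1 \<rho> \<subseteq> U" "pcube c2 \<rho> \<subseteq> V"
      using sep strip[OF sub1] strip[OF sub2] unfolding separated_cubes_def by (metis Int_absorb2)
    have free2: "pcube c2 \<rho> \<inter> \<Sigma> = {}"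
      using UV(2,5) in_components_subset by blast
    \<comment> \<open>This is the radius guaranteed by the second use of the corkscrew condition;
      sliding a cube of the same radius lets \<open>h\<close> serve in both cases below.\<close>
    define h where "h = \<gamma>0 * (\<delta> * (\<rho> / 4) / 2)"
    have h_ge: "(\<gamma>0 * \<delta> / 4)\<^sup>2 * r \<le> h"
      using mult_left_mono[OF \<rho>(1), of "\<gamma>0 * \<delta> / 8"] \<gamma>0 \<delta> by (simp add: h_def power2_eq_square)
    have h0: "0 < h"
      using \<gamma>0 \<delta> \<rho>0 by (simp add: h_def)
    have "\<gamma>0 * \<delta> < 1"
      using mult_strict_mono[of \<gamma>0 1 \<delta> 1] \<gamma>0 \<delta> by simp
    then have "(\<gamma>0 * \<delta>) * (\<rho> / 8) < 1 * (\<rho> / 8)"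
      using \<rho>0 by (intro mult_strict_right_mono) auto
    moreover have "h = (\<gamma>0 * \<delta>) * (\<rho> / 8)"
      by (simp add: h_def)
    ultimately have h_\<rho>: "h < \<rho> / 4"
      using \<rho>0 by linarith
    then have h_less: "h < \<rho>" "h < r" "h\<^sup>2 < \<rho>\<^sup>2"
      using \<rho>0 \<rho>(2) h0 by (auto intro!: power_strict_mono)
    define column where "column s = {q :: 'n ppoint.
        (\<forall>i. \<bar>fst q $ i - fst c2 $ i\<bar> < h) \<and> s < snd q \<and> snd q < snd c2 + \<rho>\<^sup>2}" for s
    \<comment> \<open>After time \<open>snd c2\<close> the column lies inside
      \<open>pcube c2 \<rho>\<close>, which is free of \<Sigma>, so only earlier obstacles have to
      be excluded. The point \<open>c2\<close> anchors the column in \<open>V\<close>.\<close>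
    have column_free: "column s \<subseteq> V" if s: "s < snd c2"
      and free: "\<And>q. q \<in> \<Sigma> \<Longrightarrow> q \<in> column s \<Longrightarrow> snd q \<le> snd c2 \<Longrightarrow> False" for s
    proof (rule components_maximal[OF UV(2)])
      show "connected (column s)"
        unfolding column_def by (rule connected_Collect_abs_nth_time)
      show "column s \<subseteq> - \<Sigma>"
      proof
        fix q assume q: "q \<in> column s"
        show "q \<in> - \<Sigma>"
        proof (cases "snd q \<le> snd c2")
          case True
          then show ?thesis using free q by blast
        next
          case False
          then have "q \<in> pcube c2 \<rho>"
            using q h_less(1) by (auto simp: column_def pcube_def intro: less_trans)
          then show ?thesis using free2 by auto
        qed
      qed
      have "c2 \<in> V"
        using UV(5) mem_pcube_self[OF \<rho>0] by blast
      moreover have "c2 \<in> column s"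
        using s h0 \<rho>0 by (simp add: column_def)
      ultimately show "V \<inter> column s \<noteq> {}" by auto
    qed
    have column_sub: "A \<subseteq> pcube_plus p r" if "A \<subseteq> column s" "snd c1 - \<rho>\<^sup>2 \<le> s" for A s
    proof
      fix q assume "q \<in> A"
      then have "q \<in> column s"
        using that(1) by blast
      then have q: "\<bar>fst q $ i - fst c2 $ i\<bar> < h" "s < snd q" "snd q < snd c2 + \<rho>\<^sup>2" for i
        by (simp_all add: column_def)
      have "(fst q, snd q) \<in> pcube_plus p r"
        using q that(2) less_trans[OF q(1) h_less(1)]
        by (intro Un_pcube_time_convex[OF sub1 sub2 \<rho>0 le]) auto
      then show "q \<in> pcube_plus p r" by simp
    qed
    \<comment> \<open>\<open>K\<close> collects the obstacles down to
      \<open>snd c1 - h\<^sup>2\<close>, the bottom of the slid cube once it is centred at time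
      \<open>snd c1\<close>. Its non-strict inequalities make it compact.\<close>
    define K where "K = {q \<in> \<Sigma>. (\<forall>i. \<bar>fst q $ i - fst c2 $ i\<bar> \<le> h) \<and>
        snd c1 - h\<^sup>2 \<le> snd q \<and> snd q \<le> snd c2}"
    have "compact K"
      unfolding K_def by (rule compact_Int_cylinder[OF cl])
    show ?thesis
    proof (cases "K = {}")
      case True
      have col: "column (snd c1 - h\<^sup>2) \<subseteq> V"
      proof (rule column_free)
        show "snd c1 - h\<^sup>2 < snd c2"
          using le h0 by (smt (verit) zero_less_power)
        fix q assume "q \<in> \<Sigma>" "q \<in> column (snd c1 - h\<^sup>2)" "snd q \<le> snd c2"
        then have "q \<in> K"
          by (simp add: K_def column_def less_imp_le)
        with True show False by blast
      qed
      \<comment> \<open>The slide is unobstructed: the slid cube, now at the time of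
        \<open>c1\<close>, is paired with the cube at \<open>c1\<close> shrunk to radius
        \<open>h\<close>.\<close>
      define c where "c = (fst c2, snd c1)"
      have cube: "pcube c h \<subseteq> column (snd c1 - h\<^sup>2)"
        using le h_less(3) by (auto simp: pcube_def c_def column_def abs_less_iff)
      have "pcube c1 h \<subseteq> pcube c1 \<rho>"
        using h0 h_less by (intro pcube_mono) auto
      moreover have "pcube c h \<subseteq> pcube_plus p r"
        using column_sub[OF cube] h_less by simp
      moreover have "separated_cubes \<Sigma> c1 c h"
        unfolding separated_cubes_def using UV(1-4) cube col calculation(1) by blast
      ultimately show ?thesis
        using h_ge h_less(2) sub1 by (intro exI[of _ h] exI[of _ c1] exI[of _ c]) (auto simp: c_def)
    next
      case False
      obtain q where q: "q \<in> K" and q_max: "\<And>q'. q' \<in> K \<Longrightarrow> snd q' \<le> snd q"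
        using continuous_attains_sup[OF \<open>compact K\<close> False continuous_on_snd[OF continuous_on_id]] by auto
      have q_space: "\<bar>fst q $ i - fst c2 $ i\<bar> < \<rho> / 4" for i
        using q by (intro le_less_trans[OF _ h_\<rho>]) (simp add: K_def)
      \<comment> \<open>In space \<open>q\<close> is within \<open>\<rho> / 4\<close> of the axis of
        \<open>c2\<close>, so it avoids \<open>pcube c2 \<rho>\<close> only by lying below it. This
        leaves a time gap of \<open>\<rho>\<^sup>2\<close> for the second round.\<close>
      have q_low: "snd q \<le> snd c2 - \<rho>\<^sup>2"
      proof (rule ccontr)
        assume "\<not> ?thesis"
        moreover have "\<bar>fst q $ i - fst c2 $ i\<bar> < \<rho>" for i
          using q_space[of i] \<rho>0 by linarith
        moreover have "snd q \<le> snd c2" using q by (simp add: K_def)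
        ultimately have "q \<in> pcube c2 \<rho>"
          by (simp add: pcube_def)
        then show False
          using q free2 by (auto simp: K_def)
      qed
      have q_time: "snd c1 - \<rho>\<^sup>2 < snd q" "q \<in> \<Sigma>"
        using q h_less(3) by (auto simp: K_def)
      have \<rho>2: "0 < \<rho>\<^sup>2" using \<rho>0 by simp
      \<comment> \<open>\<open>q\<close> is a latest point of \<open>K\<close> and the column is
        open at its lower end, so no obstacle remains in it.\<close>
      have col: "column (snd q) \<subseteq> V"
      proof (rule column_free)
        fix q' assume q': "q' \<in> \<Sigma>" "q' \<in> column (snd q)" "snd q' \<le> snd c2"
        then have "q' \<in> K"
          using q by (simp add: K_def column_def less_imp_le)
        then have "snd q' \<le> snd q"
          by (rule q_max)
        with q'(2) show False
          by (simp add: column_def)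
      qed (use q_low \<rho>2 in linarith)
      have "snd q < snd c2 + \<rho>\<^sup>2"
        using q_low \<rho>2 by linarith
      \<comment> \<open>Only the time of this point matters: it shows that \<open>q\<close> is not
        earlier than \<open>p\<close>, hence beyond \<open>T0\<close>, so that advancing from
        \<open>q\<close> is possible.\<close>
      then have "(fst c2, snd q) \<in> pcube_plus p r"
        using \<rho>0 q_time(1) by (intro Un_pcube_time_convex[OF sub1 sub2 \<rho>0 le]) simp_all
      then have q_T0: "T0 \<Sigma> < ereal (snd q)"
        by (intro later[OF p]) (simp add: pcube_plus_def)
      \<comment> \<open>With \<open>\<rho> / 4\<close>, the offsets of \<open>q\<close>, of
        \<open>p'\<close> and of the next cube add up to less than \<rho> in space, and the time
        offsets from \<open>q\<close> to less than \<open>\<rho>\<^sup>2\<close>.\<close>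
      define r' where "r' = \<rho> / 4"
      have r': "0 < r'" "ennreal r' < pdiam \<Sigma>"
        using \<rho>0 \<rho>(2) by (simp_all add: r'_def diam[OF _ r(2)])
      obtain p' where p': "p' \<in> \<Sigma>" "p' \<in> pcube q r'" "snd q + (\<delta> * r')\<^sup>2 \<le> snd p'"
        using fwd[OF q_time(2) q_T0 r'] by blast
      \<comment> \<open>\<open>p'\<close> is later than \<open>q\<close> by at least
        \<open>4 * a\<^sup>2\<close>, so the cube of radius \<open>a\<close> about it stays strictly
        after \<open>q\<close>.\<close>
      define a where "a = \<delta> * r' / 2"
      have a: "0 < a" "a < r'" "ennreal a < pdiam \<Sigma>"
      proof -
        show "0 < a" using \<delta> r' by (simp add: a_def)
        have "\<delta> * r' < 1 * r'" using \<delta> r' by (intro mult_strict_right_mono) auto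
        then show "a < r'" using r' by (simp add: a_def)
        then show "ennreal a < pdiam \<Sigma>"
          by (intro diam[OF _ r'(2)]) simp
      qed
      have h_a: "h = \<gamma>0 * a"
        by (simp add: h_def a_def r'_def)
      have sq: "(\<delta> * r')\<^sup>2 = 4 * a\<^sup>2" "\<rho>\<^sup>2 = 16 * r'\<^sup>2" "0 < a\<^sup>2" "a\<^sup>2 < r'\<^sup>2"
        using a(1) power_strict_mono[OF a(2), of 2] by (simp_all add: a_def r'_def power2_eq_square)
      have p'_T0: "T0 \<Sigma> < ereal (snd p')"
        using p'(3) sq by (intro later[OF q_T0]) linarith
      obtain \<rho>' d1 d2 where d: "\<gamma>0 * a \<le> \<rho>'" "\<rho>' < a" "pcube d1 \<rho>' \<subseteq> pcube p' a"
        "pcube d2 \<rho>' \<subseteq> pcube p' a" "separated_cubes \<Sigma> d1 d2 \<rho>'"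
        using cork[OF p'(1) p'_T0 a(1,3)] by blast
      have p'_cube: "(\<forall>i. \<bar>fst v $ i - fst c2 $ i\<bar> < \<rho>) \<and> snd q < snd v \<and> snd v < snd c2"
        if "v \<in> pcube p' a" for v
      proof (intro conjI allI)
        have "\<bar>snd p' - snd v\<bar> < a\<^sup>2" "\<bar>snd q - snd p'\<bar> < r'\<^sup>2"
          using that p'(2) by (auto simp: pcube_def)
        then show "snd q < snd v" "snd v < snd c2"
          using p'(3) sq q_low by linarith+
        fix i
        have "\<bar>fst v $ i - fst p' $ i\<bar> < a" "\<bar>fst p' $ i - fst q $ i\<bar> < r'"
          using that p'(2) by (auto simp: pcube_def)
        then show "\<bar>fst v $ i - fst c2 $ i\<bar> < \<rho>"
          using q_space[of i] a(1,2) \<rho>0 unfolding r'_def by linarith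
      qed
      have p'_sub: "pcube p' a \<subseteq> pcube_plus p r"
      proof
        fix v assume "v \<in> pcube p' a"
        note v = p'_cube[OF this]
        then have "snd c1 - \<rho>\<^sup>2 < snd v" "snd v < snd c2 + \<rho>\<^sup>2"
          using q_time(1) \<rho>2 by linarith+
        with v have "(fst v, snd v) \<in> pcube_plus p r"
          by (intro Un_pcube_time_convex[OF sub1 sub2 \<rho>0 le]) simp_all
        then show "v \<in> pcube_plus p r" by simp
      qed
      have h_\<rho>': "0 \<le> h" "h \<le> \<rho>'"
        using h0 d(1) h_a by auto
      \<comment> \<open>The two new cubes lie in distinct components, so at least one of these
        differs from \<open>V\<close>; that cube is kept.\<close>
      obtain W d where W: "W \<in> components (- \<Sigma>)" "W \<noteq> V" "pcube d \<rho>' \<subseteq> W" "pcube d \<rho>' \<subseteq> pcube p' a"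
      proof -
        obtain W1 W2 where "W1 \<in> components (- \<Sigma>)" "W2 \<in> components (- \<Sigma>)" "W1 \<noteq> W2"
          "pcube d1 \<rho>' \<subseteq> W1" "pcube d2 \<rho>' \<subseteq> W2"
          using d(5) strip[OF order_trans[OF d(3) p'_sub]] strip[OF order_trans[OF d(4) p'_sub]]
          unfolding separated_cubes_def by (metis Int_absorb2)
        with that d(3,4) show thesis by metis
      qed
      \<comment> \<open>The partner sits on the axis of \<open>c2\<close> at the time of
        \<open>d\<close>. As \<open>h \<le> \<rho>'\<close>, its time range is within that of
        \<open>pcube d \<rho>'\<close>, hence after \<open>q\<close> and inside the column.\<close>
      define c where "c = (fst c2, snd d)"
      have cube: "pcube c h \<subseteq> column (snd q)"
      proof
        fix v assume v: "v \<in> pcube c h"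
        have "\<bar>snd d - snd v\<bar> < h\<^sup>2"
          using v by (simp add: pcube_def c_def)
        also have "h\<^sup>2 \<le> \<rho>'\<^sup>2"
          using h_\<rho>' by (intro power_mono) auto
        finally have "(fst d, snd v) \<in> pcube d \<rho>'"
          using h0 h_\<rho>' by (simp add: pcube_def)
        then have "snd q < snd v" "snd v < snd c2"
          using p'_cube W(4) by fastforce+
        moreover from this have "snd v < snd c2 + \<rho>\<^sup>2"
          using \<rho>2 by linarith
        ultimately show "v \<in> column (snd q)"
          using v by (simp add: column_def pcube_def c_def)
      qed
      have d_sub: "pcube d h \<subseteq> pcube d \<rho>'"
        using h_\<rho>' by (rule pcube_mono)
      have "separated_cubes \<Sigma> d c h"
        unfolding separated_cubes_def using W(1-3) UV(2) cube col d_sub by blast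
      moreover have "pcube d h \<subseteq> pcube_plus p r"
        using d_sub W(4) p'_sub by blast
      moreover have "pcube c h \<subseteq> pcube_plus p r"
        using column_sub[OF cube] q_time(1) by simp
      ultimately show ?thesis
        using h_ge h_less(2) by (intro exI[of _ h] exI[of _ d] exI[of _ c]) (auto simp: c_def)
    qed
  qed
  have "0 < \<gamma>0 * \<delta> / 4" "\<gamma>0 * \<delta> / 4 < 1"
    using mult_strict_mono[of \<gamma>0 1 \<delta> 1] \<gamma>0 \<delta> by auto
  then have "0 < (\<gamma>0 * \<delta> / 4)\<^sup>2" "(\<gamma>0 * \<delta> / 4)\<^sup>2 < 1"
    by (auto simp: power_less_one_iff)
  show ?thesis
    unfolding weak_ts_two_cube_in_def
  proof (intro conjI ballI allI impI)
    fix p r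
    assume "p \<in> \<Sigma>" "T0 \<Sigma> < ereal (snd p) \<and> ereal (snd p) < T1 \<Sigma>" "0 < r \<and> ennreal r < pdiam \<Sigma>"
    then have p: "p \<in> \<Sigma>" "T0 \<Sigma> < ereal (snd p)" and r: "0 < r" "ennreal r < pdiam \<Sigma>"
      by auto
    have half: "ennreal (r / 2) < pdiam \<Sigma>" "0 < r / 2"
      using r by (simp_all add: diam[OF _ r(2)])
    obtain p' where p': "p' \<in> \<Sigma>" "p' \<in> pcube p (r / 2)" "snd p + (\<delta> * (r / 2))\<^sup>2 \<le> snd p'"
      using fwd[OF p half(2,1)] by blast
    \<comment> \<open>First round: the time gain guaranteed at radius \<open>r / 2\<close> is
      \<open>a\<^sup>2\<close>, so the cube of radius \<open>a\<close> about \<open>p'\<close> does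
      not reach back before \<open>p\<close>; starting from \<open>r / 2\<close> keeps it inside
      \<open>pcube p r\<close>.\<close>
    define a where "a = \<delta> * r / 2"
    have "\<delta> * r < 1 * r" using \<delta> r by (intro mult_strict_right_mono) auto
    then have a: "0 < a" "a < r / 2" using \<delta> r by (auto simp: a_def)
    have a_diam: "ennreal a < pdiam \<Sigma>"
      using a by (intro diam[OF _ half(1)]) simp
    have sq: "(\<delta> * (r / 2))\<^sup>2 = a\<^sup>2" "a\<^sup>2 < (r / 2)\<^sup>2" "r\<^sup>2 = 4 * (r / 2)\<^sup>2"
      using a(1) power_strict_mono[OF a(2), of 2] by (simp_all add: a_def power2_eq_square)
    have sub: "pcube p' a \<subseteq> pcube_plus p r"
    proof
      fix v assume v: "v \<in> pcube p' a"
      have "\<bar>fst v $ i - fst p $ i\<bar> < r" for i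
      proof -
        have "\<bar>fst v $ i - fst p' $ i\<bar> < a" "\<bar>fst p' $ i - fst p $ i\<bar> < r / 2"
          using v p'(2) by (auto simp: pcube_def)
        then show ?thesis using a(2) by linarith
      qed
      moreover have "\<bar>snd p' - snd v\<bar> < a\<^sup>2" "\<bar>snd p - snd p'\<bar> < (r / 2)\<^sup>2"
        using v p'(2) by (auto simp: pcube_def)
      then have "snd p \<le> snd v" "\<bar>snd p - snd v\<bar> < r\<^sup>2"
        using p'(3) sq by linarith+
      ultimately show "v \<in> pcube_plus p r"
        by (auto simp: pcube_def pcube_plus_def)
    qed
    have "T0 \<Sigma> < ereal (snd p')"
      using p'(3) zero_le_power2[of "\<delta> * (r / 2)"] by (intro later[OF p(2)]) linarith
    then obtain \<rho> c1 c2 where c: "\<gamma>0 * a \<le> \<rho>" "\<rho> < a" "pcube c1 \<rho> \<subseteq> pcube p' a"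
      "pcube c2 \<rho> \<subseteq> pcube p' a" "separated_cubes \<Sigma> c1 c2 \<rho>"
      using cork[OF p'(1) _ a(1) a_diam] by blast
    have \<rho>: "\<gamma>0 * (\<delta> * r / 2) \<le> \<rho>" "\<rho> < r"
      using c(1,2) a(2) r(1) unfolding a_def by linarith+
    show "\<exists>\<rho> p1 p2. (\<gamma>0 * \<delta> / 4)\<^sup>2 * r \<le> \<rho> \<and> \<rho> < r \<and>
              pcube p1 \<rho> \<subseteq> pcube_plus p r \<and> pcube p2 \<rho> \<subseteq> pcube_plus p r \<and>
              snd p1 = snd p2 \<and> separated_cubes \<Sigma> p1 p2 \<rho>"
    proof (cases "snd c1 \<le> snd c2")
      case True
      then show ?thesis
        using main[OF p(2) r \<rho> _ _ c(5)] c(3,4) sub by (meson order_trans)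
    next
      case False
      then show ?thesis
        using main[OF p(2) r \<rho> _ _ separated_cubes_sym[OF c(5)]] c(3,4) sub
        by (meson linear order_trans)
    qed
  qed fact+
qed

subsection \<open>Time reflection\<close>

definition time_reflect :: "'n::finite ppoint \<Rightarrow> 'n ppoint" where
  "time_reflect q = (fst q, - snd q)"

lemma fst_time_reflect [simp]: "fst (time_reflect q) = fst q"
  and snd_time_reflect [simp]: "snd (time_reflect q) = - snd q"
  and time_reflect_idem [simp]: "time_reflect (time_reflect q) = q"
  by (simp_all add: time_reflect_def)

lemma inj_time_reflect: "inj time_reflect"
  by (metis injI time_reflect_idem)

lemma time_reflect_image_idem [simp]: "time_reflect ` time_reflect ` A = A"
  by (simp add: image_image)

lemma mem_time_reflect_image_iff: "q \<in> time_reflect ` A \<longleftrightarrow> time_reflect q \<in> A"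
  by (metis image_iff time_reflect_idem)

lemma time_reflect_image_Compl: "time_reflect ` (- A) = - time_reflect ` A"
  by (rule set_eqI) (simp add: mem_time_reflect_image_iff)

lemma continuous_on_time_reflect: "continuous_on A time_reflect"
  unfolding time_reflect_def by (intro continuous_intros)

lemma closed_time_reflect:
  assumes "closed \<Sigma>"
  shows "closed (time_reflect ` \<Sigma>)"
proof -
  have "time_reflect ` \<Sigma> = time_reflect -` \<Sigma>"
    by (auto simp: mem_time_reflect_image_iff)
  then show ?thesis
    using closed_vimage[OF assms continuous_on_time_reflect] by simp
qed

lemma pdiam_time_reflect [simp]: "pdiam (time_reflect ` \<Sigma>) = pdiam \<Sigma>"
proof -
  have "\<bar>snd y - snd x\<bar> = \<bar>snd x - snd y\<bar>" for x y :: "'a ppoint" by simp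
  then show ?thesis
    by (simp add: pdiam_def pdist_def image_image abs_minus_commute)
qed

lemma T0_time_reflect [simp]: "T0 (time_reflect ` \<Sigma>) = - T1 \<Sigma>"
  by (simp add: T0_def T1_def image_image ereal_INF_uminus_eq flip: uminus_ereal.simps)

lemma T1_time_reflect [simp]: "T1 (time_reflect ` \<Sigma>) = - T0 \<Sigma>"
  by (simp add: T0_def T1_def image_image ereal_SUP_uminus_eq flip: uminus_ereal.simps)

lemma pcube_time_reflect [simp]: "pcube (time_reflect p) r = time_reflect ` pcube p r"
  by (auto simp: pcube_def mem_time_reflect_image_iff abs_minus_commute)

lemma pcube_plus_time_reflect [simp]: "pcube_plus (time_reflect p) r = time_reflect ` pcube_minus p r"
  by (auto simp: pcube_plus_def pcube_minus_def mem_time_reflect_image_iff)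

lemma strip_time_reflect [simp]: "strip (time_reflect ` \<Sigma>) = time_reflect ` strip \<Sigma>"
  by (auto simp: strip_def mem_time_reflect_image_iff ereal_less_uminus_reorder
      ereal_uminus_less_reorder simp flip: uminus_ereal.simps)

text \<open>\<open>time_reflect\<close> is a continuous involution, hence a homeomorphism between
  the two complements.\<close>

lemma components_time_reflect:
  assumes "U \<in> components (- \<Sigma>)"
  shows "time_reflect ` U \<in> components (- time_reflect ` \<Sigma>)"
proof -
  obtain x where x: "x \<in> - \<Sigma>" "U = connected_component_set (- \<Sigma>) x"
    using assms by (auto simp: components_iff)
  have "homeomorphism (- \<Sigma>) (- time_reflect ` \<Sigma>) time_reflect time_reflect"
    by (auto simp: homeomorphism_def continuous_on_time_reflect time_reflect_image_Compl)
  from connected_component_set_homeomorphism[OF this x(1)] x show ?thesis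
    unfolding components_iff
    by (intro exI[of _ "time_reflect x"]) (simp add: mem_time_reflect_image_iff)
qed

lemma separated_cubes_time_reflect:
  assumes "separated_cubes \<Sigma> p1 p2 \<rho>"
  shows "separated_cubes (time_reflect ` \<Sigma>) (time_reflect p1) (time_reflect p2) \<rho>"
proof -
  obtain U V where "U \<in> components (- \<Sigma>)" "V \<in> components (- \<Sigma>)" "U \<noteq> V"
    "pcube p1 \<rho> \<inter> strip \<Sigma> \<subseteq> U" "pcube p2 \<rho> \<inter> strip \<Sigma> \<subseteq> V"
    using assms by (auto simp: separated_cubes_def)
  then show ?thesis
    unfolding separated_cubes_def
    by (intro bexI[of _ "time_reflect ` U"] bexI[of _ "time_reflect ` V"])
      (auto intro: components_time_reflect simp: inj_image_eq_iff[OF inj_time_reflect]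
        inj_image_subset_iff[OF inj_time_reflect] simp flip: image_Int[OF inj_time_reflect])
qed

lemma between_times_time_reflect:
  "T0 (time_reflect ` \<Sigma>) < ereal (snd (time_reflect p)) \<and>
   ereal (snd (time_reflect p)) < T1 (time_reflect ` \<Sigma>) \<longleftrightarrow>
   T0 \<Sigma> < ereal (snd p) \<and> ereal (snd p) < T1 \<Sigma>"
  by (auto simp: ereal_less_uminus_reorder ereal_uminus_less_reorder simp flip: uminus_ereal.simps)

lemma corkscrew_time_reflect:
  assumes "corkscrew \<Sigma> \<gamma>"
  shows "corkscrew (time_reflect ` \<Sigma>) \<gamma>"
  unfolding corkscrew_def
proof (intro conjI ballI allI impI)
  fix p' r
  assume "p' \<in> time_reflect ` \<Sigma>"
    and t: "T0 (time_reflect ` \<Sigma>) < ereal (snd p') \<and> ereal (snd p') < T1 (time_reflect ` \<Sigma>)"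
    and r: "0 < r \<and> ennreal r < pdiam (time_reflect ` \<Sigma>)"
  then obtain p where p: "p' = time_reflect p" "p \<in> \<Sigma>" by auto
  with assms t r obtain \<rho> p1 p2 where "\<gamma> * r \<le> \<rho>" "\<rho> < r"
    "pcube p1 \<rho> \<subseteq> pcube p r" "pcube p2 \<rho> \<subseteq> pcube p r" "separated_cubes \<Sigma> p1 p2 \<rho>"
    unfolding corkscrew_def p(1) between_times_time_reflect pdiam_time_reflect by meson
  then show "\<exists>\<rho> p1 p2. \<gamma> * r \<le> \<rho> \<and> \<rho> < r \<and> pcube p1 \<rho> \<subseteq> pcube p' r \<and>
      pcube p2 \<rho> \<subseteq> pcube p' r \<and> separated_cubes (time_reflect ` \<Sigma>) p1 p2 \<rho>"
    by (intro exI[of _ \<rho>] exI[of _ "time_reflect p1"] exI[of _ "time_reflect p2"])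
      (auto simp: p(1) separated_cubes_time_reflect)
qed (use assms in \<open>auto simp: corkscrew_def\<close>)

lemma advances_time_reflect:
  assumes "retreats \<Sigma> \<delta>"
  shows "advances (time_reflect ` \<Sigma>) \<delta>"
  unfolding advances_def
proof (intro ballI allI impI)
  fix p' r
  assume "p' \<in> time_reflect ` \<Sigma>"
    and t: "T0 (time_reflect ` \<Sigma>) < ereal (snd p') \<and> ereal (snd p') < T1 (time_reflect ` \<Sigma>)"
    and r: "0 < r \<and> ennreal r < pdiam (time_reflect ` \<Sigma>)"
  then obtain p where p: "p' = time_reflect p" "p \<in> \<Sigma>" by auto
  with assms t r obtain q where "q \<in> \<Sigma> \<inter> pcube p r" "snd q \<le> snd p - (\<delta> * r)\<^sup>2"
    unfolding retreats_def p(1) between_times_time_reflect pdiam_time_reflect by meson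
  then show "\<exists>q\<in>time_reflect ` \<Sigma> \<inter> pcube p' r. snd p' + (\<delta> * r)\<^sup>2 \<le> snd q"
    by (intro bexI[of _ "time_reflect q"]) (auto simp: p(1))
qed

text \<open>The reflected set satisfies the forward hypotheses; the cubes found there are reflected
  back, and reflecting twice is the identity.\<close>

lemma weak_ts_two_cube_minus:
  assumes "closed \<Sigma>" "corkscrew \<Sigma> \<gamma>0" "T0 \<Sigma> = -\<infinity>" "retreats \<Sigma> \<delta>" "0 < \<delta>" "\<delta> < 1"
  shows "weak_ts_two_cube_in \<Sigma> ((\<gamma>0 * \<delta> / 4)\<^sup>2) pcube_minus"
proof -
  let ?R = "time_reflect ` \<Sigma>"
  have *: "weak_ts_two_cube_in ?R ((\<gamma>0 * \<delta> / 4)\<^sup>2) pcube_plus"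
    using assms by (intro weak_ts_two_cube_plus)
      (auto intro: closed_time_reflect corkscrew_time_reflect advances_time_reflect)
  show ?thesis
    unfolding weak_ts_two_cube_in_def
  proof (intro conjI ballI allI impI)
    fix p r
    assume "p \<in> \<Sigma>" "T0 \<Sigma> < ereal (snd p) \<and> ereal (snd p) < T1 \<Sigma>" "0 < r \<and> ennreal r < pdiam \<Sigma>"
    then obtain \<rho> p1 p2 where c: "(\<gamma>0 * \<delta> / 4)\<^sup>2 * r \<le> \<rho>" "\<rho> < r" "snd p1 = snd p2"
      "pcube p1 \<rho> \<subseteq> time_reflect ` pcube_minus p r" "pcube p2 \<rho> \<subseteq> time_reflect ` pcube_minus p r"
      "separated_cubes ?R p1 p2 \<rho>"
      using * unfolding weak_ts_two_cube_in_def
      by (metis between_times_time_reflect imageI pcube_plus_time_reflect pdiam_time_reflect)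
    from separated_cubes_time_reflect[OF c(6)] image_mono[OF c(4), of time_reflect]
      image_mono[OF c(5), of time_reflect] c(1-3)
    show "\<exists>\<rho> p1 p2. (\<gamma>0 * \<delta> / 4)\<^sup>2 * r \<le> \<rho> \<and> \<rho> < r \<and> pcube p1 \<rho> \<subseteq> pcube_minus p r \<and>
        pcube p2 \<rho> \<subseteq> pcube_minus p r \<and> snd p1 = snd p2 \<and> separated_cubes \<Sigma> p1 p2 \<rho>"
      by (intro exI[of _ \<rho>] exI[of _ "time_reflect p1"] exI[of _ "time_reflect p2"]) simp
  qed (use * in \<open>auto simp: weak_ts_two_cube_in_def\<close>)
qed

section \<open>Choice of the constant and conclusion\<close>

lemma weak_ts_two_cube_in_mono:
  assumes "weak_ts_two_cube_in \<Sigma> \<gamma> R" "\<And>p r. R p r \<subseteq> R' p r"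
  shows "weak_ts_two_cube_in \<Sigma> \<gamma> R'"
  using assms unfolding weak_ts_two_cube_in_def by (meson order_trans)

theorem theorem3p1:
  fixes M M' \<gamma>0 :: real
  assumes "M \<ge> 1" and "M' \<ge> 1" and "0 < \<gamma>0" and "\<gamma>0 < 1"
  shows "\<exists>\<gamma>1. 0 < \<gamma>1 \<and> \<gamma>1 < 1 \<and>
    (\<forall>\<Sigma> :: ((real^'n::finite) \<times> real) set.
       closed \<Sigma> \<and> parabolic_ADR \<Sigma> M \<and> corkscrew \<Sigma> \<gamma>0 \<and>
       (time_forward_ADR \<Sigma> M' \<or> time_backward_ADR \<Sigma> M') \<longrightarrow>
         weak_ts_two_cube \<Sigma> \<gamma>1 \<and>
         (time_forward_ADR \<Sigma> M' \<longrightarrow> weak_ts_two_cube_in \<Sigma> \<gamma>1 pcube_plus) \<and>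
         (time_backward_ADR \<Sigma> M' \<longrightarrow> weak_ts_two_cube_in \<Sigma> \<gamma>1 pcube_minus))"
proof -
  \<comment> \<open>\<open>m0\<close> depends only on the dimension, \<open>M\<close> and
    \<open>M'\<close> and is fixed before any \<Sigma> is given, which makes
    \<open>\<gamma>1\<close> uniform.\<close>
  obtain m0 :: nat where m0: "M * M' * 3 ^ (CARD('n) + 1) < real m0"
    using reals_Archimedean2 by blast
  \<comment> \<open>The maximum with 3 serves the layer estimate and also gives
    \<open>\<delta> < 1\<close>.\<close>
  define m where "m = max 3 m0"
  have m: "3 \<le> m" "M * M' * 3 ^ (CARD('n) + 1) < real m"
    using m0 by (auto simp: m_def)
  define \<delta> where "\<delta> = 1 / real m"
  have \<delta>: "0 < \<delta>" "\<delta> < 1"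
    using m(1) by (auto simp: \<delta>_def)
  define \<gamma>1 where "\<gamma>1 = (\<gamma>0 * \<delta> / 4)\<^sup>2"
  have "0 < \<gamma>0 * \<delta> / 4" "\<gamma>0 * \<delta> / 4 < 1"
    using mult_strict_mono[of \<gamma>0 1 \<delta> 1] assms \<delta> by auto
  then have \<gamma>1: "0 < \<gamma>1" "\<gamma>1 < 1"
    by (auto simp: \<gamma>1_def power_less_one_iff)
  have plus: "weak_ts_two_cube_in \<Sigma> \<gamma>1 pcube_plus"
    if "closed \<Sigma>" "parabolic_ADR \<Sigma> M" "corkscrew \<Sigma> \<gamma>0" "time_forward_ADR \<Sigma> M'"
    for \<Sigma> :: "'n ppoint set"
    unfolding \<gamma>1_def
    using time_forward_ADR_advances[OF that(2,4) m] that \<delta>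
    by (intro weak_ts_two_cube_plus) (auto simp: time_forward_ADR_def \<delta>_def)
  have minus: "weak_ts_two_cube_in \<Sigma> \<gamma>1 pcube_minus"
    if "closed \<Sigma>" "parabolic_ADR \<Sigma> M" "corkscrew \<Sigma> \<gamma>0" "time_backward_ADR \<Sigma> M'"
    for \<Sigma> :: "'n ppoint set"
    unfolding \<gamma>1_def
    using time_backward_ADR_retreats[OF that(2,4) m] that \<delta>
    by (intro weak_ts_two_cube_minus) (auto simp: time_backward_ADR_def \<delta>_def)
  have "weak_ts_two_cube \<Sigma> \<gamma>1"
    if "weak_ts_two_cube_in \<Sigma> \<gamma>1 pcube_plus \<or> weak_ts_two_cube_in \<Sigma> \<gamma>1 pcube_minus"
    for \<Sigma> :: "'n ppoint set"
    using that unfolding weak_ts_two_cube_def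
    by (auto elim!: weak_ts_two_cube_in_mono simp: pcube_plus_def pcube_minus_def)
  with plus minus \<gamma>1 show ?thesis
    by blast
qed

end
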